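(* Let $S=(V,E,F,\prec)$ be a closed simplicial surface that can be folded onto a triangle, i.e. $S$ has a vertex-3-colouring $c_V$ and there exists a triangle-folding of $S$ with respect to $c_V$. Then $S$ has a simplicial orientation.
   Context: A simplicial surface is a quadruple $(V,E,F,\prec)$ where $V,E,F$ are finite sets (vertices, edges, faces) and $\prec\subset (V\times E)\uplus(V\times F)\uplus(E\times F)$ is a transitive relation (incidence) such that: every edge is incident to exactly two vertices; for every face $f$ there are three vertices $v_1,v_2,v_3$ and three edges $e_1,e_2,e_3$ incident to $f$ with $v_i,v_{i+1}$ incident to $e_i$ ($v_4:=v_1$); every edge is incident to at most two faces; for every vertex $v$ there is a finite sequence $(e_1,f_1,e_2,f_2,\dots)$ whose $e_i$ are pairwise distinct and are exactly the edges incident to $v$, whose $f_i$ are pairwise distinct and are exactly the faces incident to $v$, with $e_i,e_{i+1}$ incident to $f_i$, and such that if the sequence ends with a face then $e_1$ is incident to that face; every vertex is incident to some edge; every edge is incident to some face. It is closed if every edge is incident to exactly two faces. A vertex-3-colouring is a map $c_V:V\to\{1,2,3\}$ such that the two vertices of any edge get different colours. The induced edge-3-colouring is $c_E(e)=c_V(v_1)+c_V(v_2)-2$ where $v_1,v_2$ are the vertices of $e$. A triangle-folding is a total order $<$ on $F$ such that whenever two edges have face sets $\{f_1,f_2\}$ and $\{g_1,g_2\}$ with $f_1<g_1<f_2<g_2$, these edges have different colours under $c_E$. A simplicial orientation is a map $z:F\to\{(1,2,3),(1,3,2)\}$ (values in $\mathrm{Sym}(\{1,2,3\})$) such that for any two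 faces $f_1,f_2$ with a common edge, $z(f_1)=z(f_2)^{-1}$. *)

theory Defs
  imports "HOL-Combinatorics.Cycles"
begin

definition vertices_of :: "'a set \<Rightarrow> 'a rel \<Rightarrow> 'a \<Rightarrow> 'a set" where
  "vertices_of V I x = {v \<in> V. (v, x) \<in> I}"

definition edges_of :: "'a set \<Rightarrow> 'a rel \<Rightarrow> 'a \<Rightarrow> 'a set" where
  "edges_of E I f = {e \<in> E. (e, f) \<in> I}"

definition edges_at :: "'a set \<Rightarrow> 'a rel \<Rightarrow> 'a \<Rightarrow> 'a set" where
  "edges_at E I v = {e \<in> E. (v, e) \<in> I}"

definition faces_at :: "'a set \<Rightarrow> 'a rel \<Rightarrow> 'a \<Rightarrow> 'a set" where
  "faces_at F I x = {f \<in> F. (x, f) \<in> I}"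

text \<open>
  A sequence (e_1, f_1, e_2, f_2, ...) around a vertex is given by the list es of its edges and the
  list fs of its faces.  It ends with a face if both lists have the same length, and with
  an edge if es is longer by one.
\<close>

definition umbrella :: "'a set \<Rightarrow> 'a set \<Rightarrow> 'a rel \<Rightarrow> 'a \<Rightarrow> 'a list \<Rightarrow> 'a list \<Rightarrow> bool" where
  "umbrella E F I v es fs \<longleftrightarrow>
     distinct es \<and> set es = edges_at E I v \<and>
     distinct fs \<and> set fs = faces_at F I v \<and>
     (length es = length fs \<or> length es = Suc (length fs)) \<and>
     (\<forall>i < length fs. (es ! i, fs ! i) \<in> I) \<and>
     (\<forall>i < length fs. Suc i < length es \<longrightarrow> (es ! Suc i, fs ! i) \<in> I) \<and>
     (fs \<noteq> [] \<and> length es = length fs \<longrightarrow> (hd es, last fs) \<in> I)"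

text \<open>
  Vertices, edges and faces live in one type, so their disjointness is an explicit axiom.
  In the axiom on faces, the three vertices and the three edges are pairwise distinct and are
  all the vertices and edges incident to the face.
\<close>

locale simplicial_surface =
  fixes V E F :: "'a set" and I :: "'a rel"
  assumes finite_vertices: "finite V"
    and finite_edges: "finite E"
    and finite_faces: "finite F"
    and disjoint: "V \<inter> E = {}" "V \<inter> F = {}" "E \<inter> F = {}"
    and incidence: "I \<subseteq> V \<times> E \<union> V \<times> F \<union> E \<times> F"
    and trans_incidence: "trans I"
    and edge_vertices: "\<And>e. e \<in> E \<Longrightarrow> card (vertices_of V I e) = 2"
    and face_triangle: "\<And>f. f \<in> F \<Longrightarrow>
      \<exists>v1 v2 v3 e1 e2 e3.
        distinct [v1, v2, v3] \<and> vertices_of V I f = {v1, v2, v3} \<and>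
        distinct [e1, e2, e3] \<and> edges_of E I f = {e1, e2, e3} \<and>
        (v1, e1) \<in> I \<and> (v2, e1) \<in> I \<and>
        (v2, e2) \<in> I \<and> (v3, e2) \<in> I \<and>
        (v3, e3) \<in> I \<and> (v1, e3) \<in> I"
    and edge_faces: "\<And>e. e \<in> E \<Longrightarrow> card (faces_at F I e) \<le> 2"
    and vertex_umbrella: "\<And>v. v \<in> V \<Longrightarrow> \<exists>es fs. umbrella E F I v es fs"
    and vertex_edge: "\<And>v. v \<in> V \<Longrightarrow> \<exists>e\<in>E. (v, e) \<in> I"
    and edge_face: "\<And>e. e \<in> E \<Longrightarrow> \<exists>f\<in>F. (e, f) \<in> I"

locale closed_simplicial_surface = simplicial_surface +
  assumes closed: "\<And>e. e \<in> E \<Longrightarrow> card (faces_at F I e) = 2"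

definition vertex_3_colouring :: "'a set \<Rightarrow> 'a set \<Rightarrow> 'a rel \<Rightarrow> ('a \<Rightarrow> nat) \<Rightarrow> bool" where
  "vertex_3_colouring V E I c \<longleftrightarrow>
     c ` V \<subseteq> {1, 2, 3} \<and>
     (\<forall>e\<in>E. \<forall>v\<in>vertices_of V I e. \<forall>w\<in>vertices_of V I e. v \<noteq> w \<longrightarrow> c v \<noteq> c w)"

text \<open>
  The sum has two terms, the colours of the end points of e.  They are distinct elements of
  {1, 2, 3}, so the subtraction on naturals does not truncate.
\<close>

definition edge_colour :: "'a set \<Rightarrow> 'a rel \<Rightarrow> ('a \<Rightarrow> nat) \<Rightarrow> 'a \<Rightarrow> nat" where
  "edge_colour V I c e = (\<Sum>v\<in>vertices_of V I e. c v) - 2"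

definition triangle_folding ::
  "'a set \<Rightarrow> 'a set \<Rightarrow> 'a set \<Rightarrow> 'a rel \<Rightarrow> ('a \<Rightarrow> nat) \<Rightarrow> 'a rel \<Rightarrow> bool" where
  "triangle_folding V E F I c L \<longleftrightarrow>
     L \<subseteq> F \<times> F \<and> strict_linear_order_on F L \<and>
     (\<forall>d\<in>E. \<forall>e\<in>E. \<forall>f1 f2 g1 g2.
        faces_at F I d = {f1, f2} \<and> faces_at F I e = {g1, g2} \<and>
        (f1, g1) \<in> L \<and> (g1, f2) \<in> L \<and> (f2, g2) \<in> L \<longrightarrow>
        edge_colour V I c d \<noteq> edge_colour V I c e)"

definition foldable_onto_triangle :: "'a set \<Rightarrow> 'a set \<Rightarrow> 'a set \<Rightarrow> 'a rel \<Rightarrow> bool" where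
  "foldable_onto_triangle V E F I \<longleftrightarrow>
     (\<exists>c. vertex_3_colouring V E I c \<and> (\<exists>L. triangle_folding V E F I c L))"

text \<open>
  The distinctness of the two faces is needed, since no 3-cycle is its own inverse.
\<close>

definition simplicial_orientation ::
  "'a set \<Rightarrow> 'a set \<Rightarrow> 'a rel \<Rightarrow> ('a \<Rightarrow> nat \<Rightarrow> nat) \<Rightarrow> bool" where
  "simplicial_orientation E F I z \<longleftrightarrow>
     z ` F \<subseteq> {cycle_of_list [1, 2, 3], cycle_of_list [1, 3, 2]} \<and>
     (\<forall>f1\<in>F. \<forall>f2\<in>F. f1 \<noteq> f2 \<and> edges_of E I f1 \<inter> edges_of E I f2 \<noteq> {} \<longrightarrow>
        z f1 = inv (z f2))"

end

theory Submission
  imports Defs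
begin

text \<open>
  Every face has exactly one edge of each colour, so the edges of a fixed colour match the faces in
  pairs.  A triangle-folding says that each of these matchings is non-crossing for the order on the
  faces, so the faces strictly between two matched faces are matched among themselves and their
  number is even.  Hence the ranks of adjacent faces have different parity, and orienting each face
  by the parity of its rank gives a simplicial orientation.
\<close>

lemma inv_cycle_123: "inv (cycle_of_list [1, 2, 3 :: nat]) = cycle_of_list [1, 3, 2]"
  by (rule inv_unique_comp) (auto simp: fun_eq_iff transpose_def)

lemma inv_cycle_132: "inv (cycle_of_list [1, 3, 2 :: nat]) = cycle_of_list [1, 2, 3]"
  by (rule inv_unique_comp) (auto simp: fun_eq_iff transpose_def)

context simplicial_surface
begin

lemma vertices_of_edge_eq:
  assumes "e \<in> E" "v \<in> V" "w \<in> V" "v \<noteq> w" "(v, e) \<in> I" "(w, e) \<in> I"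
  shows "vertices_of V I e = {v, w}"
proof -
  have "card (vertices_of V I e) = 2"
    using edge_vertices assms(1) .
  moreover have "finite (vertices_of V I e)"
    unfolding vertices_of_def using finite_vertices by simp
  moreover have "{v, w} \<subseteq> vertices_of V I e"
    using assms by (auto simp: vertices_of_def)
  ultimately show ?thesis
    using card_subset_eq[of "vertices_of V I e" "{v, w}"] assms(4) by simp
qed

text \<open>The vertices of a face carry all three colours, which sum to 6, so the edge opposite a
  vertex \<open>v\<close> gets colour \<open>(6 - c v) - 2 = 4 - c v\<close>. The map
  \<open>4 - x\<close> permutes {1, 2, 3}, so each colour occurs on exactly one edge.\<close>

lemma ex1_edge_of_colour:
  assumes c: "vertex_3_colouring V E I c" and f: "f \<in> F" and k: "k \<in> {1, 2, 3}"
  shows "\<exists>!e. e \<in> edges_of E I f \<and> edge_colour V I c e = k"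
proof -
  obtain v1 v2 v3 e1 e2 e3 where
    dv: "distinct [v1, v2, v3]" and v: "vertices_of V I f = {v1, v2, v3}"
    and e: "edges_of E I f = {e1, e2, e3}"
    and inc: "(v1, e1) \<in> I" "(v2, e1) \<in> I" "(v2, e2) \<in> I" "(v3, e2) \<in> I"
      "(v3, e3) \<in> I" "(v1, e3) \<in> I"
    using face_triangle[OF f] by blast
  have V: "v1 \<in> V" "v2 \<in> V" "v3 \<in> V"
    using v by (auto simp: vertices_of_def)
  have E: "e1 \<in> E" "e2 \<in> E" "e3 \<in> E"
    using e by (auto simp: edges_of_def)
  have vs: "vertices_of V I e1 = {v1, v2}" "vertices_of V I e2 = {v2, v3}"
    "vertices_of V I e3 = {v3, v1}"
    by (rule vertices_of_edge_eq; use V E inc dv in auto)+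
  have ne: "c v1 \<noteq> c v2" "c v2 \<noteq> c v3" "c v3 \<noteq> c v1"
    using c E vs dv unfolding vertex_3_colouring_def by auto
  have le: "c v1 \<in> {1, 2, 3}" "c v2 \<in> {1, 2, 3}" "c v3 \<in> {1, 2, 3}"
    using c V unfolding vertex_3_colouring_def by auto
  have sum: "c v1 + c v2 + c v3 = 6"
    using le ne by auto
  have ec: "edge_colour V I c e1 = 4 - c v3" "edge_colour V I c e2 = 4 - c v1"
    "edge_colour V I c e3 = 4 - c v2"
    using dv sum by (auto simp: edge_colour_def vs)
  have "k = 4 - c v1 \<or> k = 4 - c v2 \<or> k = 4 - c v3"
    using le ne k by auto
  then have "\<exists>d\<in>edges_of E I f. edge_colour V I c d = k"
    by (auto simp: e ec)
  moreover have "4 - c v1 \<noteq> 4 - c v2" "4 - c v2 \<noteq> 4 - c v3" "4 - c v3 \<noteq> 4 - c v1"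
    using le ne by auto
  then have "inj_on (edge_colour V I c) (edges_of E I f)"
    by (auto simp: inj_on_def e ec)
  ultimately show ?thesis
    by (auto dest: inj_onD)
qed

lemma edge_colour_range:
  assumes c: "vertex_3_colouring V E I c" and e: "e \<in> E"
  shows "edge_colour V I c e \<in> {1, 2, 3}"
proof -
  obtain v w where vw: "vertices_of V I e = {v, w}" "v \<noteq> w"
    using edge_vertices[OF e] by (auto simp: card_2_iff)
  then have "v \<in> V" "w \<in> V"
    by (auto simp: vertices_of_def)
  then have "c v \<in> {1, 2, 3}" "c w \<in> {1, 2, 3}" "c v \<noteq> c w"
    using c e vw unfolding vertex_3_colouring_def by auto
  then show ?thesis
    using vw by (auto simp: edge_colour_def)
qed

text \<open>This is the matching property: distinct edges of one colour have disjoint face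
  sets.\<close>

lemma edge_of_colour_unique:
  assumes c: "vertex_3_colouring V E I c" and d: "d \<in> E" "f \<in> faces_at F I d"
    and e: "e \<in> E" "f \<in> faces_at F I e" and "edge_colour V I c d = edge_colour V I c e"
  shows "d = e"
proof -
  have "f \<in> F" "d \<in> edges_of E I f" "e \<in> edges_of E I f"
    using d e by (auto simp: faces_at_def edges_of_def)
  then show ?thesis
    using ex1_edge_of_colour[OF c _ edge_colour_range[OF c e(1)]] assms(6) by blast
qed

end

context closed_simplicial_surface
begin

text \<open>No order between \<open>f1\<close> and \<open>f2\<close> is assumed: if
  \<open>f1\<close> does not precede \<open>f2\<close>, the set is empty by transitivity.\<close>

lemma even_card_between:
  assumes c: "vertex_3_colouring V E I c" and L: "triangle_folding V E F I c L"
    and e: "e \<in> E" and fe: "faces_at F I e = {f1, f2}"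
  shows "even (card {g \<in> F. (f1, g) \<in> L \<and> (g, f2) \<in> L})"
proof -
  define B where "B = {g \<in> F. (f1, g) \<in> L \<and> (g, f2) \<in> L}"
  \<comment> \<open>\<open>D\<close> collects the edges coloured like \<open>e\<close> with all
    their faces in \<open>B\<close>; their face sets will partition \<open>B\<close> into
    pairs.\<close>
  define D where "D = {d \<in> E. edge_colour V I c d = edge_colour V I c e \<and> faces_at F I d \<subseteq> B}"
  have irrefl: "irrefl L" and total: "total_on F L"
    using L unfolding triangle_folding_def strict_linear_order_on_def by auto
  have f12: "f1 \<in> F" "f2 \<in> F"
    using fe by (auto simp: faces_at_def)
  have noncrossing: False
    if "d \<in> E" "d' \<in> E" "edge_colour V I c d = edge_colour V I c d'"
      "faces_at F I d = {a, a'}" "faces_at F I d' = {b, b'}"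
      "(a, b) \<in> L" "(b, a') \<in> L" "(a', b') \<in> L" for d d' a a' b b'
    using L that unfolding triangle_folding_def by blast
  have "\<exists>d\<in>D. g \<in> faces_at F I d" if g: "g \<in> B" for g
  proof -
    have gF: "g \<in> F" and gL: "(f1, g) \<in> L" "(g, f2) \<in> L"
      using g by (auto simp: B_def)
    obtain d where dg: "d \<in> E" "g \<in> faces_at F I d"
      and dc: "edge_colour V I c d = edge_colour V I c e"
      using ex1_edge_of_colour[OF c gF edge_colour_range[OF c e]] gF
      by (auto simp: edges_of_def faces_at_def)
    \<comment> \<open>Closedness supplies the partner \<open>g'\<close> of \<open>g\<close> across
      \<open>d\<close>; the goal is to trap \<open>g'\<close> in \<open>B\<close> as well.\<close>
    obtain g' where fd: "faces_at F I d = {g, g'}"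
      using closed[OF dg(1)] dg(2) by (auto simp: card_2_iff doubleton_eq_iff)
    then have g'F: "g' \<in> F"
      by (auto simp: faces_at_def)
    \<comment> \<open>By irreflexivity \<open>g\<close> differs from \<open>f1\<close> and
      \<open>f2\<close>, so it is not a face of \<open>e\<close>. A face shared by \<open>d\<close>
      and \<open>e\<close> would force \<open>d = e\<close>, as they have the same colour.\<close>
    have "d \<noteq> e"
      using dg(2) gL irrefl by (auto simp: fe irrefl_def)
    then have "g' \<notin> faces_at F I e"
      using edge_of_colour_unique[OF c dg(1) _ e _ dc, of g'] by (auto simp: fd)
    then have ne: "g' \<noteq> f1" "g' \<noteq> f2"
      by (auto simp: fe)
    \<comment> \<open>Each way for \<open>g'\<close> to leave the interval gives a crossing: g' < f1
      < g < f2 on the left, f1 < g < f2 < g' on the right. The left case needs the faces of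
      \<open>d\<close> listed with \<open>g'\<close> first.\<close>
    have "faces_at F I d = {g', g}"
      using fd by auto
    then have "(g', f1) \<notin> L"
      using noncrossing[OF dg(1) e dc _ fe _ gL] by auto
    moreover have "(f2, g') \<notin> L"
      using noncrossing[OF e dg(1) dc[symmetric] fe fd gL] by blast
    ultimately have "g' \<in> B"
      using ne total f12 g'F unfolding B_def total_on_def by blast
    then show ?thesis
      using dg dc fd g by (auto simp: D_def)
  qed
  then have "B = \<Union> (faces_at F I ` D)"
    by (auto simp: D_def)
  moreover have "card (\<Union> (faces_at F I ` D)) = (\<Sum>d\<in>D. card (faces_at F I d))"
  proof (rule card_UN_disjoint)
    show "finite D"
      using finite_edges by (simp add: D_def)
    show "\<forall>d\<in>D. finite (faces_at F I d)"
      using finite_faces by (simp add: faces_at_def)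
    show "\<forall>d\<in>D. \<forall>d'\<in>D. d \<noteq> d' \<longrightarrow> faces_at F I d \<inter> faces_at F I d' = {}"
    proof (intro ballI impI equals0I)
      fix d d' f assume "d \<in> D" "d' \<in> D" "d \<noteq> d'" and "f \<in> faces_at F I d \<inter> faces_at F I d'"
      then show False
        using edge_of_colour_unique[OF c, of d f d'] by (auto simp: D_def)
    qed
  qed
  moreover have "(\<Sum>d\<in>D. card (faces_at F I d)) = 2 * card D"
    using closed by (simp add: D_def)
  ultimately show ?thesis
    unfolding B_def by simp
qed

text \<open>The faces before \<open>f2\<close> are those before \<open>f1\<close>, then
  \<open>f1\<close> itself, then the even number in between, so the two ranks differ by an odd
  number.\<close>

lemma rank_parity:
  assumes c: "vertex_3_colouring V E I c" and L: "triangle_folding V E F I c L"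
    and e: "e \<in> E" and fe: "faces_at F I e = {f1, f2}" and lt: "(f1, f2) \<in> L"
  shows "even (card {g \<in> F. (g, f2) \<in> L}) \<longleftrightarrow> odd (card {g \<in> F. (g, f1) \<in> L})"
proof -
  let ?A = "{g \<in> F. (g, f1) \<in> L}" and ?B = "{g \<in> F. (f1, g) \<in> L \<and> (g, f2) \<in> L}"
  have trans: "trans L" and irrefl: "irrefl L" and total: "total_on F L"
    using L unfolding triangle_folding_def strict_linear_order_on_def by auto
  have f1: "f1 \<in> F"
    using fe by (auto simp: faces_at_def)
  have "{g \<in> F. (g, f2) \<in> L} = insert f1 (?A \<union> ?B)"
    using lt f1 total transD[OF trans] unfolding total_on_def by blast
  moreover have "f1 \<notin> ?A \<union> ?B" "?A \<inter> ?B = {}"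
    using irrefl transD[OF trans] unfolding irrefl_def by blast+
  ultimately have "card {g \<in> F. (g, f2) \<in> L} = Suc (card ?A + card ?B)"
    using finite_faces by (simp add: card_Un_disjoint)
  then show ?thesis
    using even_card_between[OF c L e fe] by simp
qed

end

theorem theorem5p6:
  fixes V E F :: "'a set" and I :: "'a rel"
  assumes "closed_simplicial_surface V E F I"
    and "foldable_onto_triangle V E F I"
  shows "\<exists>z. simplicial_orientation E F I z"
proof -
  interpret closed_simplicial_surface V E F I by fact
  obtain c L where c: "vertex_3_colouring V E I c" and L: "triangle_folding V E F I c L"
    using assms(2) unfolding foldable_onto_triangle_def by blast
  let ?even = "\<lambda>f. even (card {g \<in> F. (g, f) \<in> L})"
  define z where "z f = (if ?even f then cycle_of_list [1, 2, 3 :: nat] else cycle_of_list [1, 3, 2])"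
    for f
  have parity: "?even f1 \<longleftrightarrow> \<not> ?even f2"
    if f: "f1 \<in> F" "f2 \<in> F" "f1 \<noteq> f2" and e: "e \<in> edges_of E I f1" "e \<in> edges_of E I f2"
    for f1 f2 e
  proof -
    have eE: "e \<in> E" and sub: "{f1, f2} \<subseteq> faces_at F I e"
      using f e by (auto simp: edges_of_def faces_at_def)
    \<comment> \<open>Two distinct faces already exhaust the faces of an edge, since the surface is
      closed.\<close>
    have fe: "faces_at F I e = {f1, f2}"
      using card_subset_eq[OF _ sub] closed[OF eE] finite_faces f(3) by (simp add: faces_at_def)
    then have fe': "faces_at F I e = {f2, f1}"
      by auto
    \<comment> \<open>\<open>rank_parity\<close> wants the smaller face first, hence both listings
      of the pair.\<close>
    have "(f1, f2) \<in> L \<or> (f2, f1) \<in> L"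
      using L f unfolding triangle_folding_def strict_linear_order_on_def total_on_def by blast
    then show ?thesis
      using rank_parity[OF c L eE fe] rank_parity[OF c L eE fe'] by blast
  qed
  \<comment> \<open>Opposite parities select the two different 3-cycles, which are inverse to each
    other.\<close>
  have "z f1 = inv (z f2)"
    if "f1 \<in> F" "f2 \<in> F" "f1 \<noteq> f2" "edges_of E I f1 \<inter> edges_of E I f2 \<noteq> {}" for f1 f2
    using parity[OF that(1-3)] that(4) inv_cycle_123 inv_cycle_132 unfolding z_def by auto
  moreover have "z ` F \<subseteq> {cycle_of_list [1, 2, 3], cycle_of_list [1, 3, 2]}"
    by (auto simp: z_def)
  ultimately show ?thesis
    unfolding simplicial_orientation_def by blast
qed

end
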